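(* Let $G$ be a graph and $n=|V(G)|$. The quantum chromatic number $\chi_q(G)$ is equal to the optimal value of the following program (whose minimum is attained), in matrix variables $X^1,\dots,X^n$, where $X^t$ is indexed by $\{0\}\cup(V(G)\times[t])$: $$\begin{array}{lll} \min & \sum_{t\in[n]}t\,X^t_{0,0}\\ \text{s.t.} & X^t\in\mathcal{CS}_+^{nt+1} & \forall t\in[n],\\ & \sum_{t\in[n]}X^t_{0,0}=1,\quad \sum_{t\in[n]}\langle A^t,X^t\rangle=0,\\ & X^t_{ui,vi}=0 & \forall i\in[t],\ \forall\{u,v\}\in E(G),\ \forall t\in[n],\\ & X^t_{ui,uj}=0 & \forall i\neq j\in[t],\ \forall u\in V(G),\ \forall t\in[n]. \end{array}$$
   Context: Graphs are finite, undirected, without loops, with at least one vertex; $[t]=\{1,\dots,t\}$. $\mathcal S^d$ denotes the real symmetric $d\times d$ matrices with trace inner product $\langle X,Y\rangle=\mathrm{Tr}(XY)$, and $\mathcal S^d_+$ the positive semidefinite ones. $\mathcal{CS}_+^m$ is the set of $A\in\mathcal S^m$ for which there exist $d\ge1$ and $X_1,\dots,X_m\in\mathcal S^d_+$ with $A_{ij}=\langle X_i,X_j\rangle$ for all $i,j$. $\chi_q(G)$ is the minimum $t\in\mathbb N$ for which there exist $d\ge1$ and matrices $\rho,\rho_u^i\in\mathcal S^d_+$ ($i\in[t]$, $u\in V(G)$) with: $\langle\rho,\rho\rangle=1$; $\sum_{i\in[t]}\rho_u^i=\rho$ for all $u\in V(G)$; $\langle\rho_u^i,\rho_v^i\rangle=0$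 for all $i\in[t]$ and $\{u,v\}\in E(G)$; $\langle\rho_u^i,\rho_u^j\rangle=0$ for all $i\ne j\in[t]$ and $u\in V(G)$. For $u\in V(G)$ and $t\in[n]$, $A_u^t\in\mathcal S^{nt+1}$ is the matrix indexed by $\{0\}\cup(V(G)\times[t])$ with entries $A_u^t(0,0)=A_u^t(ui,uj)=1$ for all $i,j\in[t]$, $A_u^t(0,ui)=A_u^t(ui,0)=-1$ for all $i\in[t]$, and zero elsewhere; $A^t=\sum_{u\in V(G)}A_u^t$. Here $ui$ abbreviates the index $(u,i)$. *)

theory Defs
  imports
    Complex_Main
    "Jordan_Normal_Form.Matrix"
    "Graph_Theory.Digraph"
begin

text \<open>A finite undirected loopless graph is a \<^locale>\<open>graph\<close> of \<^theory>\<open>Graph_Theory.Digraph\<close>: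
  the edge $\{u,v\}$ is represented by the two opposite arcs between \<open>u\<close> and \<open>v\<close>.\<close>

definition mat_trace :: "'a :: comm_monoid_add mat \<Rightarrow> 'a" where
  "mat_trace A = (\<Sum>i<dim_row A. A $$ (i, i))"

definition trace_inner :: "real mat \<Rightarrow> real mat \<Rightarrow> real" where
  "trace_inner X Y = mat_trace (X * Y)"

definition psd_mats :: "nat \<Rightarrow> real mat set" where
  "psd_mats d = {M \<in> carrier_mat d d.
     transpose_mat M = M \<and> (\<forall>x \<in> carrier_vec d. 0 \<le> x \<bullet> (M *\<^sub>v x))}"

text \<open>A matrix whose rows and columns are indexed by a finite set \<open>I\<close> is a function
  \<open>'i \<Rightarrow> 'i \<Rightarrow> real\<close> of which only the values on \<open>I \<times> I\<close> matter.\<close>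

definition completely_psd :: "'i set \<Rightarrow> ('i \<Rightarrow> 'i \<Rightarrow> real) set" where
  "completely_psd I = {A. (\<forall>i\<in>I. \<forall>j\<in>I. A i j = A j i) \<and>
     (\<exists>d\<ge>1. \<exists>X. (\<forall>i\<in>I. X i \<in> psd_mats d) \<and>
        (\<forall>i\<in>I. \<forall>j\<in>I. A i j = trace_inner (X i) (X j)))}"

text \<open>$\mathrm{Tr}(AB)$ for matrices indexed by \<open>I\<close>.\<close>

definition trace_inner_on :: "'i set \<Rightarrow> ('i \<Rightarrow> 'i \<Rightarrow> real) \<Rightarrow> ('i \<Rightarrow> 'i \<Rightarrow> real) \<Rightarrow> real" where
  "trace_inner_on I A B = (\<Sum>p\<in>I. \<Sum>q\<in>I. A p q * B q p)"

definition quantum_colourable :: "('v, 'e) pre_digraph \<Rightarrow> nat \<Rightarrow> bool" where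
  "quantum_colourable G t \<longleftrightarrow>
    (\<exists>d\<ge>1. \<exists>\<rho> R. \<rho> \<in> psd_mats d \<and>
      (\<forall>u\<in>verts G. \<forall>i\<in>{1..t}. R u i \<in> psd_mats d) \<and>
      trace_inner \<rho> \<rho> = 1 \<and>
      (\<forall>u\<in>verts G. \<forall>a<d. \<forall>b<d. (\<Sum>i\<in>{1..t}. R u i $$ (a, b)) = \<rho> $$ (a, b)) \<and>
      (\<forall>i\<in>{1..t}. \<forall>u v. u \<rightarrow>\<^bsub>G\<^esub> v \<longrightarrow> trace_inner (R u i) (R v i) = 0) \<and>
      (\<forall>u\<in>verts G. \<forall>i\<in>{1..t}. \<forall>j\<in>{1..t}. i \<noteq> j \<longrightarrow> trace_inner (R u i) (R u j) = 0))"

definition quantum_chromatic_number :: "('v, 'e) pre_digraph \<Rightarrow> nat" where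
  "quantum_chromatic_number G = (LEAST t. quantum_colourable G t)"

text \<open>The minimum exists: giving each vertex its own colour is a quantum colouring with \<open>d = 1\<close>.\<close>

lemma quantum_colourable_card_verts:
  assumes "graph G"
  shows "quantum_colourable G (card (verts G))"
proof -
  interpret graph G by fact
  define n where "n = card (verts G)"
  obtain g where g: "bij_betw g {1..n} (verts G)"
    unfolding n_def using ex_bij_betw_nat_finite_1[OF finite_verts] by blast
  define f where "f = the_inv_into {1..n} g"
  have f: "bij_betw f (verts G) {1..n}"
    unfolding f_def using g by (rule bij_betw_the_inv_into)
  have mem: "f u \<in> {1..n}" if "u \<in> verts G" for u
    using bij_betwE[OF f] that by blast
  define R :: "'a \<Rightarrow> nat \<Rightarrow> real mat" where "R = (\<lambda>u i. if f u = i then 1\<^sub>m 1 else 0\<^sub>m 1 1)"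
  have psd: "1\<^sub>m 1 \<in> psd_mats 1" "0\<^sub>m 1 1 \<in> psd_mats 1"
    unfolding psd_mats_def by (auto simp: scalar_prod_def)
  have R_psd: "R u i \<in> psd_mats 1" for u i
    using psd by (simp add: R_def)
  have inner: "trace_inner (1\<^sub>m 1) (1\<^sub>m 1) = 1" "trace_inner (0\<^sub>m 1 1) (0\<^sub>m 1 1) = 0"
    "trace_inner (0\<^sub>m 1 1) (1\<^sub>m 1) = 0" "trace_inner (1\<^sub>m 1) (0\<^sub>m 1 1) = 0"
    unfolding trace_inner_def mat_trace_def by (simp_all add: scalar_prod_def)
  have edge: "trace_inner (R u i) (R v i) = 0" if "u \<rightarrow>\<^bsub>G\<^esub> v" for u v i
  proof -
    have "u \<noteq> v" using that no_loops by (auto simp: arcs_ends_conv)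
    moreover have "u \<in> verts G" "v \<in> verts G" using that by (auto simp: arcs_ends_conv)
    ultimately have "f u \<noteq> f v" using bij_betw_imp_inj_on[OF f] by (meson inj_onD)
    then show ?thesis using inner by (simp add: R_def)
  qed
  have vert: "trace_inner (R u i) (R u j) = 0" if "i \<noteq> j" for u i j
    using that inner by (simp add: R_def)
  have sums: "(\<Sum>i\<in>{1..n}. R u i $$ (a, b)) = 1\<^sub>m 1 $$ (a, b)"
    if "u \<in> verts G" "a < 1" "b < 1" for u a b
  proof -
    have "(\<Sum>i\<in>{1..n}. R u i $$ (a, b)) = (\<Sum>i\<in>{1..n}. if f u = i then 1 else 0)"
      using that by (intro sum.cong; simp add: R_def)
    also have "\<dots> = 1" using mem[OF that(1)] by (simp only: sum.delta' finite_atLeastAtMost if_True)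
    finally show ?thesis using that by simp
  qed
  show ?thesis
    unfolding quantum_colourable_def n_def[symmetric]
  proof (intro exI[of _ 1] conjI exI[of _ "1\<^sub>m 1"] exI[of _ R])
    show "\<forall>u\<in>verts G. \<forall>a<1. \<forall>b<1. (\<Sum>i\<in>{1..n}. R u i $$ (a, b)) = 1\<^sub>m 1 $$ (a, b)"
      using sums by blast
  qed (use psd R_psd inner edge vert in \<open>blast | simp\<close>)+
qed

lemma quantum_colourable_quantum_chromatic_number:
  assumes "graph G"
  shows "quantum_colourable G (quantum_chromatic_number G)"
  unfolding quantum_chromatic_number_def
  by (rule LeastI) (rule quantum_colourable_card_verts[OF assms])

datatype 'v qindex = Zero | Idx 'v nat

definition qindices :: "('v, 'e) pre_digraph \<Rightarrow> nat \<Rightarrow> 'v qindex set" where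
  "qindices G t = insert Zero ((\<lambda>(u, i). Idx u i) ` (verts G \<times> {1..t}))"

fun A_vertex :: "nat \<Rightarrow> 'v \<Rightarrow> 'v qindex \<Rightarrow> 'v qindex \<Rightarrow> real" where
  "A_vertex t u Zero Zero = 1"
| "A_vertex t u Zero (Idx v i) = (if v = u \<and> i \<in> {1..t} then -1 else 0)"
| "A_vertex t u (Idx v i) Zero = (if v = u \<and> i \<in> {1..t} then -1 else 0)"
| "A_vertex t u (Idx v i) (Idx w j) =
     (if v = u \<and> w = u \<and> i \<in> {1..t} \<and> j \<in> {1..t} then 1 else 0)"

definition A_graph :: "('v, 'e) pre_digraph \<Rightarrow> nat \<Rightarrow> 'v qindex \<Rightarrow> 'v qindex \<Rightarrow> real" where
  "A_graph G t p q = (\<Sum>u\<in>verts G. A_vertex t u p q)"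

definition qprog_objective ::
  "('v, 'e) pre_digraph \<Rightarrow> (nat \<Rightarrow> 'v qindex \<Rightarrow> 'v qindex \<Rightarrow> real) \<Rightarrow> real" where
  "qprog_objective G X = (\<Sum>t\<in>{1..card (verts G)}. real t * X t Zero Zero)"

definition qprog_feasible ::
  "('v, 'e) pre_digraph \<Rightarrow> (nat \<Rightarrow> 'v qindex \<Rightarrow> 'v qindex \<Rightarrow> real) \<Rightarrow> bool" where
  "qprog_feasible G X \<longleftrightarrow> (let n = card (verts G) in
    (\<forall>t\<in>{1..n}. X t \<in> completely_psd (qindices G t)) \<and>
    (\<Sum>t\<in>{1..n}. X t Zero Zero) = 1 \<and>
    (\<Sum>t\<in>{1..n}. trace_inner_on (qindices G t) (A_graph G t) (X t)) = 0 \<and>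
    (\<forall>t\<in>{1..n}. \<forall>i\<in>{1..t}. \<forall>u v. u \<rightarrow>\<^bsub>G\<^esub> v \<longrightarrow> X t (Idx u i) (Idx v i) = 0) \<and>
    (\<forall>t\<in>{1..n}. \<forall>u\<in>verts G. \<forall>i\<in>{1..t}. \<forall>j\<in>{1..t}. i \<noteq> j \<longrightarrow>
       X t (Idx u i) (Idx u j) = 0))"

end

theory Submission
  imports Defs
begin

text \<open>Since \<open>A_vertex t u\<close> is the rank-one matrix of the vector with entry \<open>1\<close> at \<open>0\<close> and
  \<open>-1\<close> at each \<open>ui\<close>, pairing it with the Gram matrix of matrices \<open>M p\<close> gives the squared Frobenius
  norm of \<open>M 0 - (\<Sum>i. M (ui))\<close>. Hence \<open>\<langle>A\<^sup>t, X\<^sup>t\<rangle> = 0\<close> says exactly that a Gram representation of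
  \<open>X\<^sup>t\<close> satisfies the sum condition of a quantum colouring, and if moreover \<open>X\<^sup>t\<^sub>0\<^sub>0 > 0\<close>, rescaling
  the representation yields a quantum colouring with \<open>t\<close> colours. So a feasible point is a
  probability distribution \<open>X\<^sup>t\<^sub>0\<^sub>0\<close> supported on values \<open>t \<ge> \<chi>\<^sub>q\<close>, and its objective value is the
  mean. The bound is attained by a point mass at \<open>\<chi>\<^sub>q\<close>.\<close>

section \<open>Positive semidefinite matrices and the trace inner product\<close>

lemma psd_matsD:
  assumes "M \<in> psd_mats d"
  shows "M \<in> carrier_mat d d" and "a < d \<Longrightarrow> b < d \<Longrightarrow> M $$ (b, a) = M $$ (a, b)"
proof -
  show M: "M \<in> carrier_mat d d" using assms by (simp add: psd_mats_def)
  assume "a < d" "b < d"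
  then have "transpose_mat M $$ (a, b) = M $$ (b, a)" using M by auto
  then show "M $$ (b, a) = M $$ (a, b)" using assms by (simp add: psd_mats_def)
qed

lemma zero_mem_psd_mats: "0\<^sub>m d d \<in> psd_mats d"
  by (auto simp: psd_mats_def scalar_prod_def)

lemma smult_mem_psd_mats:
  assumes "M \<in> psd_mats d" and "0 \<le> c"
  shows "c \<cdot>\<^sub>m M \<in> psd_mats d"
proof -
  have M: "M \<in> carrier_mat d d" by (rule psd_matsD(1)[OF assms(1)])
  have "x \<bullet> ((c \<cdot>\<^sub>m M) *\<^sub>v x) = c * (x \<bullet> (M *\<^sub>v x))" if "x \<in> carrier_vec d" for x
    using that M
    by (auto simp: scalar_prod_def mult_mat_vec_def sum_distrib_left mult_ac intro!: sum.cong)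
  moreover have "transpose_mat (c \<cdot>\<^sub>m M) = c \<cdot>\<^sub>m M"
    using M psd_matsD(2)[OF assms(1)] by (intro eq_matI) auto
  ultimately show ?thesis
    using assms M by (simp add: psd_mats_def)
qed

text \<open>Symmetry of \<open>Y\<close> turns the trace of the product into the entrywise inner
  product; scaling, commutativity and nonnegativity of \<open>trace_inner X X\<close> are then read
  off entry by entry.\<close>

lemma trace_inner_psd_mats:
  assumes "X \<in> psd_mats d" and "Y \<in> psd_mats d"
  shows "trace_inner X Y = (\<Sum>a<d. \<Sum>b<d. X $$ (a, b) * Y $$ (a, b))"
  using psd_matsD(1)[OF assms(1)] psd_matsD[OF assms(2)]
  by (auto simp: trace_inner_def mat_trace_def scalar_prod_def atLeast0LessThan intro!: sum.cong)

lemma trace_inner_smult: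
  assumes "X \<in> psd_mats d" and "Y \<in> psd_mats d" and "0 \<le> c"
  shows "trace_inner (c \<cdot>\<^sub>m X) (c \<cdot>\<^sub>m Y) = c\<^sup>2 * trace_inner X Y"
  using psd_matsD(1)[OF assms(1)] psd_matsD(1)[OF assms(2)]
  by (simp add: trace_inner_psd_mats[OF assms(1,2)]
      trace_inner_psd_mats[OF smult_mem_psd_mats smult_mem_psd_mats, OF assms(1,3,2,3)]
      sum_distrib_left power2_eq_square mult_ac)

lemma trace_inner_self_nonneg: "X \<in> psd_mats d \<Longrightarrow> 0 \<le> trace_inner X X"
  by (simp add: trace_inner_psd_mats sum_nonneg)

lemma zero_mem_completely_psd: "(\<lambda>_ _. 0) \<in> completely_psd I"
  unfolding completely_psd_def
  by (auto intro!: exI[of _ 1] exI[of _ "\<lambda>_. 0\<^sub>m 1 1"] zero_mem_psd_mats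
      simp: trace_inner_def mat_trace_def scalar_prod_def)

lemma trace_inner_commute:
  "X \<in> psd_mats d \<Longrightarrow> Y \<in> psd_mats d \<Longrightarrow> trace_inner X Y = trace_inner Y X"
  by (simp add: trace_inner_psd_mats mult.commute)

section \<open>The pairing with \<open>A_graph\<close> as a sum of squares\<close>

fun vertex_vec :: "nat \<Rightarrow> 'v \<Rightarrow> 'v qindex \<Rightarrow> real" where
  "vertex_vec t u Zero = 1"
| "vertex_vec t u (Idx v i) = (if v = u \<and> i \<in> {1..t} then -1 else 0)"

lemma A_vertex_rank_one: "A_vertex t u p q = vertex_vec t u p * vertex_vec t u q"
  by (cases p; cases q) auto

text \<open>Meant for one matrix position at a time, with \<open>x p\<close> the entry of
  \<open>M p\<close> there: the result is the defect of the sum condition at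
  \<open>u\<close>.\<close>

lemma sum_vertex_vec:
  assumes "finite (verts G)" and "u \<in> verts G"
  shows "(\<Sum>p\<in>qindices G t. vertex_vec t u p * x p) = x Zero - (\<Sum>i\<in>{1..t}. x (Idx u i))"
proof -
  let ?J = "(\<lambda>(v, i). Idx v i) ` (verts G \<times> {1..t})"
  have "inj_on (\<lambda>(v, i). Idx v i) (verts G \<times> {1..t})"
    by (auto simp: inj_on_def)
  then have "(\<Sum>p\<in>?J. vertex_vec t u p * x p) =
      (\<Sum>(v, i)\<in>verts G \<times> {1..t}. vertex_vec t u (Idx v i) * x (Idx v i))"
    by (subst sum.reindex) (simp_all add: case_prod_unfold)
  also have "\<dots> = (\<Sum>v\<in>verts G. if v = u then - (\<Sum>i\<in>{1..t}. x (Idx v i)) else 0)"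
    by (subst sum.cartesian_product[symmetric])
      (auto simp: sum_negf[symmetric] intro!: sum.cong)
  also have "\<dots> = - (\<Sum>i\<in>{1..t}. x (Idx u i))"
    using assms by simp
  finally show ?thesis
    unfolding qindices_def using assms(1) by (subst sum.insert) auto
qed

text \<open>For a fixed vertex and a fixed position \<open>(a, b)\<close>, the summand is a product
  of a factor in \<open>p\<close> and the same factor in \<open>q\<close>, so the double sum over
  \<open>p\<close> and \<open>q\<close> is a square.\<close>

lemma trace_inner_on_A_graph:
  assumes "finite (verts G)"
    and "\<forall>p\<in>qindices G t. M p \<in> psd_mats d"
    and "\<forall>p\<in>qindices G t. \<forall>q\<in>qindices G t. X p q = trace_inner (M p) (M q)"
  shows "trace_inner_on (qindices G t) (A_graph G t) X =
    (\<Sum>u\<in>verts G. \<Sum>a<d. \<Sum>b<d. (M Zero $$ (a, b) - (\<Sum>i\<in>{1..t}. M (Idx u i) $$ (a, b)))\<^sup>2)"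
proof -
  let ?I = "qindices G t" and ?c = "vertex_vec t"
  have "trace_inner_on ?I (A_graph G t) X = (\<Sum>p\<in>?I. \<Sum>q\<in>?I. \<Sum>u\<in>verts G. \<Sum>a<d. \<Sum>b<d.
      (?c u p * M p $$ (a, b)) * (?c u q * M q $$ (a, b)))"
    unfolding trace_inner_on_def
  proof (intro sum.cong refl)
    fix p q assume "p \<in> ?I" "q \<in> ?I"
    then have "X q p = (\<Sum>a<d. \<Sum>b<d. M p $$ (a, b) * M q $$ (a, b))"
      using assms(2,3) trace_inner_psd_mats[of "M q" d "M p"] by (simp add: mult.commute)
    then show "A_graph G t p q * X q p = (\<Sum>u\<in>verts G. \<Sum>a<d. \<Sum>b<d.
        (?c u p * M p $$ (a, b)) * (?c u q * M q $$ (a, b)))"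
      by (simp add: A_graph_def A_vertex_rank_one sum_distrib_right)
        (simp add: sum_distrib_left mult_ac)
  qed
  also have "\<dots> = (\<Sum>u\<in>verts G. \<Sum>a<d. \<Sum>b<d. \<Sum>p\<in>?I. \<Sum>q\<in>?I.
      (?c u p * M p $$ (a, b)) * (?c u q * M q $$ (a, b)))"
    \<comment> \<open>Fixing both index sets orients the swaps: sums over \<open>?I\<close> only
      move inwards, so the rewriting terminates.\<close>
    by (simp only: sum.swap[of _ "verts G" ?I] sum.swap[of _ "{..<d}" ?I])
  also have "\<dots> = (\<Sum>u\<in>verts G. \<Sum>a<d. \<Sum>b<d. (\<Sum>p\<in>?I. ?c u p * M p $$ (a, b))\<^sup>2)"
    by (simp add: power2_eq_square sum_product)
  also have "\<dots> = (\<Sum>u\<in>verts G. \<Sum>a<d. \<Sum>b<d.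
      (M Zero $$ (a, b) - (\<Sum>i\<in>{1..t}. M (Idx u i) $$ (a, b)))\<^sup>2)"
    using sum_vertex_vec[OF assms(1)] by (intro sum.cong refl) simp
  finally show ?thesis .
qed

text \<open>At any vertex the empty sum forces \<rho> to vanish, against its norm being 1.\<close>

lemma not_quantum_colourable_0:
  assumes "verts G \<noteq> {}"
  shows "\<not> quantum_colourable G 0"
proof
  assume "quantum_colourable G 0"
  then obtain d \<rho> where \<rho>: "\<rho> \<in> psd_mats d" "trace_inner \<rho> \<rho> = 1"
    and "\<forall>a<d. \<forall>b<d. 0 = \<rho> $$ (a, b)"
    unfolding quantum_colourable_def using assms by fastforce
  then have "trace_inner \<rho> \<rho> = 0"
    by (simp add: trace_inner_psd_mats flip: \<open>\<forall>a<d. \<forall>b<d. 0 = \<rho> $$ (a, b)\<close>[rule_format])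
  with \<rho> show False by simp
qed

section \<open>Quantum colourings against feasible points, and the optimal value\<close>

lemma quantum_colourable_imp_feasible:
  assumes "graph G" and "quantum_colourable G t" and t: "t \<in> {1..card (verts G)}"
  obtains X where "qprog_feasible G X" and "qprog_objective G X = real t"
proof -
  interpret graph G by fact
  let ?n = "card (verts G)"
  obtain d \<rho> R where d: "d \<ge> 1" and \<rho>: "\<rho> \<in> psd_mats d"
    and R: "\<forall>u\<in>verts G. \<forall>i\<in>{1..t}. R u i \<in> psd_mats d"
    and norm: "trace_inner \<rho> \<rho> = 1"
    and sums: "\<forall>u\<in>verts G. \<forall>a<d. \<forall>b<d. (\<Sum>i\<in>{1..t}. R u i $$ (a, b)) = \<rho> $$ (a, b)"
    and edge: "\<forall>i\<in>{1..t}. \<forall>u v. u \<rightarrow>\<^bsub>G\<^esub> v \<longrightarrow> trace_inner (R u i) (R v i) = 0"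
    and vert: "\<forall>u\<in>verts G. \<forall>i\<in>{1..t}. \<forall>j\<in>{1..t}. i \<noteq> j \<longrightarrow> trace_inner (R u i) (R u j) = 0"
    using assms(2) unfolding quantum_colourable_def by blast
  define M where "M p = (case p of Zero \<Rightarrow> \<rho> | Idx u i \<Rightarrow> R u i)" for p
  define Y where "Y p q = trace_inner (M p) (M q)" for p q
  \<comment> \<open>All weight goes to block \<open>t\<close>; zero blocks satisfy every constraint
    on them trivially.\<close>
  define X where "X s = (if s = t then Y else (\<lambda>_ _. 0))" for s
  have M: "\<forall>p\<in>qindices G t. M p \<in> psd_mats d"
    using \<rho> R by (auto simp: qindices_def M_def)
  have cpsd: "Y \<in> completely_psd (qindices G t)"
    unfolding completely_psd_def using M d trace_inner_commute by (fastforce simp: Y_def)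
  have "trace_inner_on (qindices G t) (A_graph G t) Y = 0"
    by (subst trace_inner_on_A_graph[OF finite_verts M])
      (use sums in \<open>simp_all add: Y_def M_def\<close>)
  then have trace: "trace_inner_on (qindices G s) (A_graph G s) (X s) = 0" for s
    by (simp add: X_def trace_inner_on_def)
  have X00: "X s Zero Zero = (if s = t then 1 else 0)" for s
    by (simp add: X_def Y_def M_def norm)
  show thesis
  proof
    show "qprog_feasible G X"
      unfolding qprog_feasible_def Let_def
    proof (intro conjI)
      show "\<forall>s\<in>{1..?n}. X s \<in> completely_psd (qindices G s)"
        using cpsd by (simp add: X_def zero_mem_completely_psd)
      show "(\<Sum>s\<in>{1..?n}. X s Zero Zero) = 1"
        using t by (simp add: X00)
      show "(\<Sum>s\<in>{1..?n}. trace_inner_on (qindices G s) (A_graph G s) (X s)) = 0"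
        by (simp add: trace)
    qed (use edge vert in \<open>auto simp: X_def Y_def M_def\<close>)
    have "qprog_objective G X = (\<Sum>s\<in>{1..?n}. if s = t then real t else 0)"
      unfolding qprog_objective_def by (intro sum.cong) (auto simp: X00)
    also have "\<dots> = real t"
      using t by simp
    finally show "qprog_objective G X = real t" .
  qed
qed

text \<open>The entry at \<open>Zero\<close> is a squared norm, hence nonnegative. When it is
  nonzero it can be normalised to 1, and scaling preserves the sum condition and the orthogonality
  relations.\<close>

lemma feasible_imp_quantum_colourable:
  assumes "graph G" and "qprog_feasible G X" and t: "t \<in> {1..card (verts G)}"
  shows "0 \<le> X t Zero Zero" and "X t Zero Zero \<noteq> 0 \<Longrightarrow> quantum_colourable G t"
proof -
  interpret graph G by fact
  let ?n = "card (verts G)"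
  have cpsd: "\<exists>d\<ge>1. \<exists>M. (\<forall>p\<in>qindices G s. M p \<in> psd_mats d) \<and>
      (\<forall>p\<in>qindices G s. \<forall>q\<in>qindices G s. X s p q = trace_inner (M p) (M q))"
    if "s \<in> {1..?n}" for s
    using assms(2) that by (simp add: qprog_feasible_def completely_psd_def Let_def)
  \<comment> \<open>The program only constrains the total of these traces; as each is a sum of
    squares, they must vanish separately.\<close>
  have "0 \<le> trace_inner_on (qindices G s) (A_graph G s) (X s)" if "s \<in> {1..?n}" for s
    using cpsd[OF that] by (auto simp: trace_inner_on_A_graph intro!: sum_nonneg)
  moreover have "(\<Sum>s\<in>{1..?n}. trace_inner_on (qindices G s) (A_graph G s) (X s)) = 0"
    using assms(2) by (simp add: qprog_feasible_def Let_def)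
  ultimately have trace: "trace_inner_on (qindices G t) (A_graph G t) (X t) = 0"
    using t by (subst (asm) sum_nonneg_eq_0_iff) (simp_all only: finite_atLeastAtMost)
  obtain d M where d: "d \<ge> 1" and M: "\<forall>p\<in>qindices G t. M p \<in> psd_mats d"
    and gram: "\<forall>p\<in>qindices G t. \<forall>q\<in>qindices G t. X t p q = trace_inner (M p) (M q)"
    using cpsd[OF t] by blast
  have Zero: "Zero \<in> qindices G t"
    and Idx: "\<And>u i. u \<in> verts G \<Longrightarrow> i \<in> {1..t} \<Longrightarrow> Idx u i \<in> qindices G t"
    by (auto simp: qindices_def)
  have X00: "X t Zero Zero = trace_inner (M Zero) (M Zero)"
    using gram Zero by blast
  then show "0 \<le> X t Zero Zero"
    using M Zero trace_inner_self_nonneg by metis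
  moreover assume "X t Zero Zero \<noteq> 0"
  ultimately have pos: "X t Zero Zero > 0" by simp
  have sums: "(\<Sum>i\<in>{1..t}. M (Idx u i) $$ (a, b)) = M Zero $$ (a, b)"
    if "u \<in> verts G" "a < d" "b < d" for u a b
    using trace that unfolding trace_inner_on_A_graph[OF finite_verts M gram]
    by (simp add: sum_nonneg_eq_0_iff sum_nonneg)
  \<comment> \<open>The inner product scales by the square of \<open>c\<close>, so this choice gives
    the scaled matrix at \<open>Zero\<close> norm 1.\<close>
  define c where "c = 1 / sqrt (X t Zero Zero)"
  have c: "0 \<le> c" "c\<^sup>2 * X t Zero Zero = 1"
    using pos by (simp_all add: c_def power_divide)
  have scaled: "trace_inner (c \<cdot>\<^sub>m M p) (c \<cdot>\<^sub>m M q) = c\<^sup>2 * X t p q"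
    if "p \<in> qindices G t" "q \<in> qindices G t" for p q
    using M gram that c(1) trace_inner_smult by metis
  have scaled_sums: "(\<Sum>i\<in>{1..t}. (c \<cdot>\<^sub>m M (Idx u i)) $$ (a, b)) = (c \<cdot>\<^sub>m M Zero) $$ (a, b)"
    if "u \<in> verts G" "a < d" "b < d" for u a b
  proof -
    have "(c \<cdot>\<^sub>m M p) $$ (a, b) = c * M p $$ (a, b)" if "p \<in> qindices G t" for p
      using psd_matsD(1) M that \<open>a < d\<close> \<open>b < d\<close> by fastforce
    then show ?thesis
      using sums[OF that] Zero Idx[OF that(1)] by (simp flip: sum_distrib_left)
  qed
  show "quantum_colourable G t"
    unfolding quantum_colourable_def
  proof (intro exI[of _ d] conjI d exI[of _ "c \<cdot>\<^sub>m M Zero"] exI[of _ "\<lambda>u i. c \<cdot>\<^sub>m M (Idx u i)"])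
    show "c \<cdot>\<^sub>m M Zero \<in> psd_mats d"
      "\<forall>u\<in>verts G. \<forall>i\<in>{1..t}. c \<cdot>\<^sub>m M (Idx u i) \<in> psd_mats d"
      using M Zero Idx c(1) by (auto intro!: smult_mem_psd_mats)
    show "trace_inner (c \<cdot>\<^sub>m M Zero) (c \<cdot>\<^sub>m M Zero) = 1"
      using scaled Zero c(2) by simp
    show "\<forall>u\<in>verts G. \<forall>a<d. \<forall>b<d.
        (\<Sum>i\<in>{1..t}. (c \<cdot>\<^sub>m M (Idx u i)) $$ (a, b)) = (c \<cdot>\<^sub>m M Zero) $$ (a, b)"
      using scaled_sums by blast
    have "\<forall>i\<in>{1..t}. \<forall>u v. u \<rightarrow>\<^bsub>G\<^esub> v \<longrightarrow> X t (Idx u i) (Idx v i) = 0"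
      using assms(2) t unfolding qprog_feasible_def Let_def by blast
    then show "\<forall>i\<in>{1..t}. \<forall>u v. u \<rightarrow>\<^bsub>G\<^esub> v \<longrightarrow>
        trace_inner (c \<cdot>\<^sub>m M (Idx u i)) (c \<cdot>\<^sub>m M (Idx v i)) = 0"
      \<comment> \<open>The Gram identity holds only on \<open>qindices G t\<close>;
        \<open>adj_in_verts\<close> places both endpoints of the arc there.\<close>
      using scaled Idx adj_in_verts by simp
    have "\<forall>u\<in>verts G. \<forall>i\<in>{1..t}. \<forall>j\<in>{1..t}. i \<noteq> j \<longrightarrow> X t (Idx u i) (Idx u j) = 0"
      using assms(2) t unfolding qprog_feasible_def Let_def by blast
    then show "\<forall>u\<in>verts G. \<forall>i\<in>{1..t}. \<forall>j\<in>{1..t}. i \<noteq> j \<longrightarrow>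
        trace_inner (c \<cdot>\<^sub>m M (Idx u i)) (c \<cdot>\<^sub>m M (Idx u j)) = 0"
      using scaled Idx by simp
  qed
qed

text \<open>The weights \<open>X t Zero Zero\<close> sum to 1, so the constant \<open>?k\<close> is
  its own mean and can be compared with the objective term by term.\<close>

lemma quantum_chromatic_number_le_objective:
  assumes "graph G" and "qprog_feasible G X"
  shows "real (quantum_chromatic_number G) \<le> qprog_objective G X"
proof -
  let ?n = "card (verts G)" and ?k = "quantum_chromatic_number G"
  have "real ?k = (\<Sum>t\<in>{1..?n}. real ?k * X t Zero Zero)"
    using assms(2) by (simp add: qprog_feasible_def Let_def flip: sum_distrib_left)
  also have "\<dots> \<le> qprog_objective G X"
    unfolding qprog_objective_def
  proof (rule sum_mono)
    fix t assume t: "t \<in> {1..?n}"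
    show "real ?k * X t Zero Zero \<le> real t * X t Zero Zero"
    proof (cases "X t Zero Zero = 0")
      case False
      then have "?k \<le> t"
        unfolding quantum_chromatic_number_def
        by (intro Least_le feasible_imp_quantum_colourable(2)[OF assms t])
      then show ?thesis
        using feasible_imp_quantum_colourable(1)[OF assms t] by (simp add: mult_right_mono)
    qed simp
  qed
  finally show ?thesis .
qed

theorem proposition4p16:
  fixes G :: "('v, 'e) pre_digraph"
  assumes "graph G" and "verts G \<noteq> {}"
  shows "\<exists>X. is_arg_min (qprog_objective G) (qprog_feasible G) X \<and>
             qprog_objective G X = real (quantum_chromatic_number G)"
proof -
  let ?k = "quantum_chromatic_number G"
  have col: "quantum_colourable G ?k"
    by (rule quantum_colourable_quantum_chromatic_number[OF assms(1)])
  \<comment> \<open>The program has blocks only for \<open>t\<close> from 1 to the number of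
    vertices, so \<open>?k\<close> must be shown to lie in that range before a point mass can be
    placed there.\<close>
  moreover have "?k \<noteq> 0"
    using col not_quantum_colourable_0[OF assms(2)] by metis
  moreover have "?k \<le> card (verts G)"
    unfolding quantum_chromatic_number_def
    by (rule Least_le) (rule quantum_colourable_card_verts[OF assms(1)])
  ultimately obtain X where "qprog_feasible G X" "qprog_objective G X = real ?k"
    using quantum_colourable_imp_feasible[OF assms(1)] by (metis atLeastAtMost_iff less_one not_le)
  then show ?thesis
    using quantum_chromatic_number_le_objective[OF assms(1)]
    by (fastforce simp: is_arg_min_def not_less)
qed

end
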